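(* Let $B\ge 2$ be an integer base, let $L>0$, and fix an integer $m>2$. Choose $p_1,p_2,\dots,p_{m-1}\in(0,1)$ such that $p_1+p_2+\cdots+p_{m-1}<1$, and set $p_m:=1-(p_1+\cdots+p_{m-1})$. Start with a stick of length $L$; at each stage, cut every remaining stick into $m$ sub-sticks according to the proportions $p_1,\dots,p_m$ (a stick of length $x$ is replaced by $m$ sticks of lengths $p_1x,\dots,p_mx$). After stage $N$ there are $m^N$ sticks in total (counted with multiplicity), of lengths $$A^{(N)}_{k_1,k_2,\dots,k_m}=L\,p_1^{k_1}p_2^{k_2}\cdots p_m^{k_m},$$ for all integers $0\le k_1,\dots,k_m\le N$ with $k_1+\cdots+k_m=N$. Let $X^{(N)}$ be the length of a stick picked uniformly at random from the $m^N$ sticks obtained at stage $N$, and let $y_i=\log_B(p_i/p_{i+1})$ for $1\le i\le m-1$. Then the sequence $\{X^{(N)}\}_{N=1}^\infty$ converges to strong Benford behavior in base $B$ if and only if $y_i\notin\mathbb{Q}$ for some $1\le i\le m-1$. Moreover, when some $y_i$ is irrational, let $\kappa_0$ be the least irrationality exponent among all the irrational $y_i$'s. Then there is some $\delta>0$ such that for every $\epsilon'>0$ and all sufficiently large $N$, the discrepancy of the finite sequence formed by the base-$B$ logarithms of the $m^N$ stick lengths at stage $N$ (listed with multiplicity, not necessarily distinct) is $$O\!\left(N^{\delta\left(-\frac{1}{\kappa_0-1}+\epsilon'\right)}\right).$$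
   Context: Significand: for $x>0$ write uniquely $x=S_B(x)\,B^{k_B(x)}$ with $S_B(x)\in[1,B)$ and $k_B(x)\in\mathbb{Z}$; $S_B(x)$ is the significand of $x$ in base $B$. Strong Benford behavior: a sequence of positive random variables $\{X^{(N)}\}_{N\ge1}$ converges to strong Benford behavior in base $B$ if $\lim_{N\to\infty}\mathbb{P}(S_B(X^{(N)})\le s)=\log_B(s)$ for all $s\in[1,B)$. Irrationality exponent: the irrationality exponent of a real number $x$ is the supremum of the set of $\mu$ such that $0<|x-p/q|<1/q^{\mu}$ is satisfied by infinitely many coprime integer pairs $(p,q)$ with $q>0$; it is $\infty$ if this set is unbounded. If $\kappa_0=\infty$, the quantity $1/(\kappa_0-1)$ is read as $0$. Discrepancy: for a finite real sequence $\{x_i\}_{i=1}^M$ and $0\le a<b\le1$, let $A([a,b),M)$ be the number of indices $i$ with $x_i \bmod 1\in[a,b)$. The discrepancy of the sequence is $D_M:=\sup_{0\le a<b\le 1}\left|\frac{A([a,b),M)}{M}-(b-a)\right|$. *)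

theory Defs
  imports "HOL-Probability.Probability" "HOL-Library.Landau_Symbols"
begin

definition significand :: "nat \<Rightarrow> real \<Rightarrow> real" where
  "significand B x = (THE s. 1 \<le> s \<and> s < real B \<and> (\<exists>k::int. x = s * real B powi k))"

lemma significand_unique:
  assumes "2 \<le> B" and "0 < x"
  shows "\<exists>!s. 1 \<le> s \<and> s < real B \<and> (\<exists>k::int. x = s * real B powi k)"
proof -
  have B: "real B > 1" using assms(1) by simp
  have eq: "s = real B powr frac (log (real B) x)"
    if s: "1 \<le> s" "s < real B" "x = s * real B powi k" for s :: real and k :: int
  proof -
    have "log (real B) x = log (real B) s + of_int k"
      using s B by (simp add: log_mult powr_real_of_int' [symmetric])
    moreover have "0 \<le> log (real B) s" "log (real B) s < 1"
      using s B by auto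
    ultimately have "frac (log (real B) x) = log (real B) s"
      by (simp add: frac_unique_iff)
    then show ?thesis using s B by simp
  qed
  show ?thesis
  proof (intro ex1I conjI exI)
    let ?l = "log (real B) x"
    show "1 \<le> real B powr frac ?l" using B by (simp add: ge_one_powr_ge_zero)
    show "real B powr frac ?l < real B"
      using powr_less_mono[OF frac_lt_1[of ?l] B] B by simp
    have "x = real B powr (frac ?l + of_int \<lfloor>?l\<rfloor>)"
      using assms B by (simp add: frac_def)
    then show "x = real B powr frac ?l * real B powi \<lfloor>?l\<rfloor>"
      using B by (simp add: powr_add powr_real_of_int')
  next
    show "s = real B powr frac (log (real B) x)"
      if "1 \<le> s \<and> s < real B \<and> (\<exists>k::int. x = s * real B powi k)" for s
      using that eq by blast
  qed
qed

text \<open>The random variables may live on different probability spaces.\<close>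

definition strong_benford :: "nat \<Rightarrow> (nat \<Rightarrow> 'a measure) \<Rightarrow> (nat \<Rightarrow> 'a \<Rightarrow> real) \<Rightarrow> bool" where
  "strong_benford B M X \<longleftrightarrow>
     (\<forall>N. prob_space (M N) \<and> X N \<in> borel_measurable (M N) \<and> (\<forall>\<omega>\<in>space (M N). 0 < X N \<omega>)) \<and>
     (\<forall>s. 1 \<le> s \<and> s < real B \<longrightarrow>
        (\<lambda>N. measure (M N) {\<omega> \<in> space (M N). significand B (X N \<omega>) \<le> s})
          \<longlonglongrightarrow> log (real B) s)"

definition irrationality_exponent :: "real \<Rightarrow> ereal" where
  "irrationality_exponent x =
     Sup (ereal ` {\<mu>. infinite {(a::int, q::int). 0 < q \<and> coprime a q \<and>
       0 < \<bar>x - of_int a / of_int q\<bar> \<and>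
       \<bar>x - of_int a / of_int q\<bar> < 1 / of_int q powr \<mu>}})"

definition discrepancy :: "real list \<Rightarrow> real" where
  "discrepancy xs =
     (SUP (a, b) \<in> {(a, b). 0 \<le> a \<and> a < b \<and> b \<le> 1}.
        \<bar>real (card {i. i < length xs \<and> frac (xs ! i) \<in> {a..<b}}) / real (length xs) - (b - a)\<bar>)"

text \<open>The lengths of the sticks after stage \<open>N\<close>, as a list so that multiplicities are kept;
  the proportions are \<open>p 1, \<dots>, p m\<close>.\<close>

primrec sticks :: "nat \<Rightarrow> (nat \<Rightarrow> real) \<Rightarrow> real \<Rightarrow> nat \<Rightarrow> real list" where
  "sticks m p L 0 = [L]"
| "sticks m p L (Suc N) = concat (map (\<lambda>x. map (\<lambda>i. p i * x) [1..<Suc m]) (sticks m p L N))"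

lemma length_sticks: "length (sticks m p L N) = m ^ N"
  by (induction N) (simp_all add: length_concat o_def sum_list_triv)

lemma set_sticks:
  "set (sticks m p L N) = {L * (\<Prod>i=1..m. p i ^ k i) | k. (\<Sum>i=1..m. k i) = N}"
proof (induction N)
  case 0
  have "(\<Prod>i=1..m. p i ^ k i) = 1" if "(\<Sum>i=1..m. k i) = 0" for k :: "nat \<Rightarrow> nat"
    using that by (intro prod.neutral) simp
  moreover have "(\<Sum>i=1..m. (\<lambda>_. 0::nat) i) = 0" by simp
  ultimately show ?case by (auto intro!: exI[of _ "\<lambda>_. 0::nat"])
next
  case (Suc N)
  have upd: "(\<Prod>i=1..m. p i ^ (k(j := Suc (k j))) i) = p j * (\<Prod>i=1..m. p i ^ k i)"
       "(\<Sum>i=1..m. (k(j := Suc (k j))) i) = Suc (\<Sum>i=1..m. k i)"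
    if "j \<in> {1..m}" for j and k :: "nat \<Rightarrow> nat"
    using that by (simp_all add: prod.remove[of _ j] sum.remove[of _ j])
  have step: "set (sticks m p L (Suc N)) = {p j * z | j z. j \<in> {1..m} \<and> z \<in> set (sticks m p L N)}"
    by (force simp del: upt_Suc)
  show ?case
  proof (intro equalityI subsetI)
    fix x assume "x \<in> set (sticks m p L (Suc N))"
    then obtain z j where z: "z \<in> set (sticks m p L N)" and j: "j \<in> {1..m}" and xz: "x = p j * z"
      unfolding step by blast
    from z obtain k where k: "(\<Sum>i=1..m. k i) = N" and zk: "z = L * (\<Prod>i=1..m. p i ^ k i)"
      unfolding Suc by blast
    have x: "x = p j * (L * (\<Prod>i=1..m. p i ^ k i))" using xz zk by simp
    moreover have "x = L * (\<Prod>i=1..m. p i ^ (k(j := Suc (k j))) i)"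
      unfolding upd(1)[OF j] using x by simp
    moreover have "(\<Sum>i=1..m. (k(j := Suc (k j))) i) = Suc N"
      unfolding upd(2)[OF j] using k by simp
    ultimately show "x \<in> {L * (\<Prod>i=1..m. p i ^ k i) | k. (\<Sum>i=1..m. k i) = Suc N}"
      by blast
  next
    fix x assume "x \<in> {L * (\<Prod>i=1..m. p i ^ k i) | k. (\<Sum>i=1..m. k i) = Suc N}"
    then obtain k where k: "(\<Sum>i=1..m. k i) = Suc N" and x: "x = L * (\<Prod>i=1..m. p i ^ k i)"
      by blast
    then obtain j where j: "j \<in> {1..m}" "k j \<noteq> 0"
      by (metis nat.distinct(1) sum.neutral)
    define k' where "k' = k(j := k j - 1)"
    have kk: "k = k'(j := Suc (k' j))" using j by (auto simp: k'_def)
    have "(\<Sum>i=1..m. k' i) = N" using upd(2)[OF j(1), of k', folded kk] k by simp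
    then have "L * (\<Prod>i=1..m. p i ^ k' i) \<in> set (sticks m p L N)"
      using Suc by blast
    moreover have "x = p j * (L * (\<Prod>i=1..m. p i ^ k' i))"
      using x unfolding upd(1)[OF j(1), of k', folded kk] by simp
    ultimately show "x \<in> set (sticks m p L (Suc N))"
      using j(1) unfolding step by blast
  qed
qed

end

theory Submission
  imports Defs "HOL-Real_Asymp.Real_Asymp"
begin

text \<open>
  In logarithms, a random stick of stage \<open>N\<close> is a sum of \<open>N\<close> independent steps, each uniform on the
  numbers \<open>log B (p i)\<close>. Benford behaviour is equidistribution of this sum modulo 1, so everything is
  governed by the exponential sums with frequency \<open>h\<close> over the sticks. Such a sum factorises into the
  \<open>N\<close>-th power of the sum over the \<open>m\<close> proportions (\<open>norm_sum_sticks_character\<close>). After division by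
  \<open>m\<close> the latter has modulus at most \<open>1 - 4 d^2 / m\<close>, where \<open>d\<close> is the distance of \<open>h * y i\<close> to the
  integers, for whichever \<open>i\<close> one likes (\<open>norm_sum_cis_le\<close>).

  If some \<open>y i\<close> is irrational, then \<open>d\<close> is positive for every \<open>h\<close>, the sums decay, and Weyl's criterion
  gives Benford behaviour. If all \<open>y i\<close> are rational with common denominator \<open>h\<close>, then \<open>h\<close> times the
  logarithm is the same modulo 1 for all sticks of one stage, so the logarithms are confined to \<open>h\<close>
  equally spaced points and cannot equidistribute (\<open>rational_imp_not_benford\<close>).

  For the discrepancy, an inequality of Erdos-Turan type bounds the deviation of any frequency by
  \<open>2 * H powr (-1/3)\<close> plus \<open>2 * H\<close> times the largest normalised exponential sum with frequency below
  \<open>H\<close> (\<open>frequency_diff_le\<close>); it comes from smoothing intervals with the Fejer kernel. The sharp form of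
  this inequality would have \<open>1 / H\<close> in the first term, but the free factor \<open>\<delta>\<close> in the exponent absorbs the
  difference. For \<open>\<mu>\<close> above the irrationality exponent \<open>\<kappa>\<close>, \<open>d\<close> is at least a constant times
  \<open>h powr (1 - \<mu>)\<close> (\<open>irrational_approximation_ge\<close>). The sums up to \<open>H\<close> are then negligible as long as
  \<open>H\<close> is a power of \<open>N\<close> with exponent below \<open>1 / (2 * (\<kappa> - 1))\<close>, which yields the rate with
  \<open>\<delta> = 1/6\<close>.
\<close>

section \<open>The Fejer kernel\<close>

lemma sin_pi_ge_twice:
  fixes x :: real
  assumes "0 \<le> x" "x \<le> 1/2"
  shows "2 * x \<le> sin (pi * x)"
proof -
  have "convex_on {0..pi} (\<lambda>t. - sin t)"
  proof (rule f''_ge0_imp_convex[where f' = "\<lambda>t. - cos t" and f'' = "\<lambda>t. sin t"])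
    fix t :: real
    show "((\<lambda>t. - sin t) has_real_derivative - cos t) (at t)" "((\<lambda>t. - cos t) has_real_derivative sin t) (at t)"
      by (auto intro!: derivative_eq_intros)
    show "0 \<le> sin t" if "t \<in> {0..pi}" using that by (auto intro: sin_ge_zero)
  qed auto
  from convex_onD[OF this, of "2 * x" 0 "pi/2"] show ?thesis
    using assms by (simp add: field_simps)
qed

lemma norm_cis_diff_one:
  fixes t :: real
  shows "cmod (cis (2 * t) - 1) = 2 * \<bar>sin t\<bar>"
proof -
  have "cis (2*t) - 1 = 2 * \<i> * of_real (sin t) * cis t"
    by (simp add: complex_eq_iff cos_double_sin sin_double power2_eq_square)
  then show ?thesis by (simp add: norm_mult)
qed

text \<open>A chord of the unit circle is at least as long as a fixed multiple of its arc: with \<open>r\<close> the signed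
  distance from \<open>t\<close> to the nearest integer, the chord has length \<open>2 |sin (pi r)|\<close>, and the sine is
  concave on \<open>[0, pi/2]\<close>. The tail of the kernel and the decay of the exponential sums over the
  sticks both come from this inequality.\<close>

lemma norm_cis_diff_one_ge:
  fixes t d :: real
  assumes "\<And>k::int. d \<le> \<bar>t - of_int k\<bar>"
  shows "4 * d \<le> cmod (cis (2 * pi * t) - 1)"
proof -
  define r where "r = t - of_int (round t)"
  have r: "\<bar>r\<bar> \<le> 1/2" using of_int_round_abs_le[of t] unfolding r_def by linarith
  have "cis (2 * pi * t) = cis (2 * (pi * r)) * cis (2 * pi * of_int (round t))"
    unfolding r_def cis_mult by (simp add: algebra_simps)
  also have "\<dots> = cis (2 * (pi * r))"
    by (metis cis_multiple_2pi Ints_of_int mult.right_neutral)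
  finally have "cmod (cis (2 * pi * t) - 1) = 2 * \<bar>sin (pi * r)\<bar>"
    by (simp add: norm_cis_diff_one)
  moreover have "2 * \<bar>r\<bar> \<le> \<bar>sin (pi * r)\<bar>"
    using sin_pi_ge_twice[of "\<bar>r\<bar>"] r by (cases "r \<ge> 0") auto
  moreover have "d \<le> \<bar>r\<bar>"
    using assms[of "round t"] unfolding r_def .
  ultimately show ?thesis by linarith
qed

text \<open>The Fejer kernel of period 1, as the double sum of cosines that results from expanding the square
  in \<open>fejer_eq_norm\<close>. In this form its mean over a period and its values summed over a point set
  can be read off frequency by frequency.\<close>

definition fejer :: "nat \<Rightarrow> real \<Rightarrow> real" where
  "fejer H t = (\<Sum>j<H. \<Sum>k<H. cos (2 * pi * (real j - real k) * t)) / real H"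

lemma fejer_eq_norm: "fejer H t = (cmod (\<Sum>j<H. cis (2 * pi * t) ^ j))\<^sup>2 / real H"
proof -
  let ?z = "\<lambda>j. cis (2 * pi * real j * t)"
  have pw: "cis (2 * pi * t) ^ j = ?z j" for j
    by (simp only: Complex.DeMoivre) (simp add: algebra_simps)
  have "complex_of_real ((cmod (\<Sum>j<H. ?z j))\<^sup>2) = (\<Sum>j<H. ?z j) * cnj (\<Sum>j<H. ?z j)"
    by (rule complex_norm_square)
  also have "\<dots> = (\<Sum>j<H. \<Sum>k<H. ?z j * cnj (?z k))"
    by (simp add: sum_product)
  also have "\<dots> = (\<Sum>j<H. \<Sum>k<H. cis (2 * pi * (real j - real k) * t))"
    by (intro sum.cong refl) (simp add: cis_cnj cis_mult algebra_simps)
  finally have "Re (complex_of_real ((cmod (\<Sum>j<H. ?z j))\<^sup>2))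
      = Re (\<Sum>j<H. \<Sum>k<H. cis (2 * pi * (real j - real k) * t))" by simp
  then show ?thesis by (simp add: fejer_def pw)
qed

lemma fejer_nonneg: "0 \<le> fejer H t"
  by (simp add: fejer_eq_norm)

lemma continuous_on_fejer [continuous_intros]:
  fixes f :: "real \<Rightarrow> real"
  assumes "continuous_on A f"
  shows "continuous_on A (\<lambda>t. fejer H (f t))"
  unfolding fejer_def divide_inverse by (intro continuous_intros assms)

lemma fejer_add_int: "fejer H (t + of_int k) = fejer H t"
proof -
  have "cis (2 * pi * (t + of_int k)) = cis (2 * pi * t) * cis (2 * pi * of_int k)"
    unfolding cis_mult by (simp add: algebra_simps)
  also have "\<dots> = cis (2 * pi * t)"
    by (metis cis_multiple_2pi Ints_of_int mult.right_neutral)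
  finally show ?thesis by (simp add: fejer_eq_norm)
qed

lemma fejer_minus: "fejer H (- t) = fejer H t"
  by (simp add: fejer_def)

text \<open>Away from the integers the geometric sum \<open>\<Sum>j<H. z ^ j\<close> equals \<open>(z ^ H - 1) / (z - 1)\<close> and stays
  bounded as \<open>H\<close> grows, so that the division by \<open>H\<close> makes the kernel small there.\<close>

lemma fejer_tail_le:
  assumes "0 < \<eta>" "\<eta> \<le> t" "t \<le> 1 - \<eta>"
  shows "fejer H t \<le> 1 / (4 * real H * \<eta>\<^sup>2)"
proof -
  let ?z = "cis (2 * pi * t)"
  have "\<eta> \<le> \<bar>t - of_int k\<bar>" for k :: int
  proof (cases "k \<le> 0")
    case False
    then have "1 \<le> real_of_int k" by simp
    then show ?thesis using assms by linarith
  next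
    case True
    then have "real_of_int k \<le> 0" by simp
    then show ?thesis using assms by linarith
  qed
  then have z: "4 * \<eta> \<le> cmod (?z - 1)" by (rule norm_cis_diff_one_ge)
  have "cmod (?z - 1) * cmod (\<Sum>j<H. ?z ^ j) = cmod (?z ^ H - 1)"
    by (metis norm_mult power_diff_1_eq)
  also have "\<dots> \<le> 2"
    using norm_triangle_ineq4[of "?z ^ H" 1] by (simp add: norm_power)
  finally have "4 * \<eta> * cmod (\<Sum>j<H. ?z ^ j) \<le> 2"
    using mult_right_mono[OF z norm_ge_zero] by (meson order_trans)
  then have "cmod (\<Sum>j<H. ?z ^ j) \<le> 1 / (2 * \<eta>)" using assms by (simp add: field_simps)
  then have "(cmod (\<Sum>j<H. ?z ^ j))\<^sup>2 \<le> (1 / (2 * \<eta>))\<^sup>2" by (intro power_mono) auto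
  then have "fejer H t \<le> (1 / (2 * \<eta>))\<^sup>2 / real H"
    unfolding fejer_eq_norm by (rule divide_right_mono) simp
  then show ?thesis by (simp add: power_divide power_mult_distrib field_simps)
qed

lemma integral_fejer_period:
  assumes "0 < H"
  shows "(fejer H has_integral 1) {a..a + 1}"
proof -
  have *: "((\<lambda>t. cos (2 * pi * (real j - real k) * t)) has_integral (if j = k then 1 else 0)) {a..a+1}" for j k
  proof (cases "j = k")
    case True
    then show ?thesis using has_integral_const_real[of "1::real" a "a+1"] by simp
  next
    case False
    let ?w = "2 * pi * (real j - real k)"
    have "((\<lambda>t. cos (?w * t)) has_integral (sin (?w * (a+1)) / ?w - sin (?w * a) / ?w)) {a..a+1}"
      using False
      by (intro fundamental_theorem_of_calculus)
         (auto intro!: derivative_eq_intros simp flip: has_real_derivative_iff_has_vector_derivative)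
    moreover have "sin (?w * (a+1)) = sin (?w * a)"
    proof -
      have "?w * (a+1) = ?w * a + of_int (int j - int k) * (2 * pi)" by (simp add: algebra_simps)
      then show ?thesis
        using sin.plus_of_int[of "?w * a" "int j - int k", unfolded of_real_eq_id id_apply]
        by (simp only:)
    qed
    ultimately show ?thesis using False by simp
  qed
  have "((\<lambda>t. (\<Sum>j<H. \<Sum>k<H. cos (2 * pi * (real j - real k) * t)) / real H)
      has_integral (\<Sum>j<H. \<Sum>k<H. if j = k then 1 else 0) / real H) {a..a+1}"
    by (intro has_integral_divide has_integral_sum * finite_lessThan)
  moreover have "(\<Sum>j<H. \<Sum>k<H. if j = k then 1 else 0 :: real) = real H" by simp
  ultimately show ?thesis using assms unfolding fejer_def[abs_def] by simp
qed

lemma integral_fejer_centre: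
  assumes H: "0 < H" and \<eta>: "0 < \<eta>" "\<eta> \<le> 1/2"
  shows "1 - 1 / (4 * real H * \<eta>\<^sup>2) \<le> integral {-\<eta>..\<eta>} (fejer H)"
proof -
  have int: "fejer H integrable_on {u..v}" for u v
    by (intro integrable_continuous_real continuous_intros)
  let ?\<tau> = "1 / (4 * real H * \<eta>\<^sup>2)"
  have "1 = integral {-\<eta>..1-\<eta>} (fejer H)"
    using integral_fejer_period[OF H, of "-\<eta>"] by (simp add: integral_unique)
  also have "\<dots> = integral {-\<eta>..\<eta>} (fejer H) + integral {\<eta>..1-\<eta>} (fejer H)"
    using \<eta> by (intro Henstock_Kurzweil_Integration.integral_combine[symmetric] int) auto
  also have "integral {\<eta>..1-\<eta>} (fejer H) \<le> integral {\<eta>..1-\<eta>} (\<lambda>_. ?\<tau>)"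
    by (intro integral_le int) (auto intro!: fejer_tail_le \<eta>)
  also have "\<dots> = (1 - 2 * \<eta>) * ?\<tau>" using \<eta> by simp
  also have "\<dots> \<le> 1 * ?\<tau>" using \<eta> by (intro mult_right_mono) auto
  finally show ?thesis by simp
qed

section \<open>Frequencies from exponential sums\<close>

text \<open>The diagonal terms of the kernel contribute the number of points, and every other term is the real
  part of an exponential sum over the points, rotated by the shift \<open>t\<close>. The bound is uniform in \<open>t\<close>,
  so it can be integrated over an arc.\<close>

lemma sum_fejer_le:
  fixes x :: "'a \<Rightarrow> real"
  assumes H: "0 < H"
    and T: "\<And>h::nat. 0 < h \<Longrightarrow> h < H \<Longrightarrow> cmod (\<Sum>i\<in>I. cis (2 * pi * real h * x i)) \<le> T"
    and "0 \<le> T"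
  shows "(\<Sum>i\<in>I. fejer H (x i - t)) \<le> real (card I) + real H * T"
proof -
  have cs: "(\<Sum>i\<in>I. cos (2 * pi * real h * (x i - t))) \<le> T" if "0 < h" "h < H" for h :: nat
  proof -
    have "(\<Sum>i\<in>I. cos (2 * pi * real h * (x i - t)))
        = Re (cis (- 2 * pi * real h * t) * (\<Sum>i\<in>I. cis (2 * pi * real h * x i)))"
      by (simp add: sum_distrib_left cis_mult algebra_simps del: cis.simps) (simp add: algebra_simps)
    also have "\<dots> \<le> cmod (cis (- 2 * pi * real h * t) * (\<Sum>i\<in>I. cis (2 * pi * real h * x i)))"
      by (rule complex_Re_le_cmod)
    also have "\<dots> \<le> T" using T[OF that] by (simp add: norm_mult)
    finally show ?thesis .
  qed
  have cjk: "(\<Sum>i\<in>I. cos (2 * pi * (real j - real k) * (x i - t)))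
      \<le> (if j = k then real (card I) else 0) + T" if "j < H" "k < H" for j k
  proof (cases j k rule: linorder_cases)
    case equal
    then show ?thesis using \<open>0 \<le> T\<close> by simp
  next
    case greater
    then show ?thesis using cs[of "j - k"] that by (simp add: of_nat_diff)
  next
    case less
    (* cos is even, so only positive frequencies have to be controlled. *)
    have "cos (2 * pi * (real j - real k) * (x i - t)) = cos (2 * pi * real (k - j) * (x i - t))" for i
      using less by (subst cos_minus[symmetric]) (simp add: of_nat_diff algebra_simps)
    then show ?thesis using cs[of "k - j"] that less by simp
  qed
  have "(\<Sum>i\<in>I. fejer H (x i - t))
      = (\<Sum>j<H. \<Sum>k<H. \<Sum>i\<in>I. cos (2 * pi * (real j - real k) * (x i - t))) / real H"
    unfolding fejer_def sum_divide_distrib[symmetric]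
    by (subst sum.swap, subst (2) sum.swap) (rule refl)
  also have "\<dots> \<le> (\<Sum>j<H. \<Sum>k<H. (if j = k then real (card I) else 0) + T) / real H"
    by (intro divide_right_mono sum_mono cjk) auto
  also have "(\<Sum>j<H. \<Sum>k<H. (if j = k then real (card I) else 0) + T) = real H * (real (card I) + real H * T)"
    by (simp add: sum.distrib algebra_simps)
  finally show ?thesis using H by simp
qed

text \<open>A one-sided inequality of Erdos-Turan type. Integrating the Fejer kernel centred at \<open>x i\<close> over the
  arc enlarged by \<open>\<eta>\<close> on both sides gives almost 1 for every point in the arc, and a nonnegative
  number for all the others. Summing over the points and exchanging sum and integral reduces the
  count to the exponential sums. Arcs are taken modulo 1 and may wrap around, so that complements of
  intervals are covered as well.\<close>

lemma arc_count_le: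
  fixes x :: "'a \<Rightarrow> real"
  assumes I: "finite I" "I \<noteq> {}" and J: "J \<subseteq> I"
    and H: "0 < H" and \<eta>: "0 < \<eta>" "\<eta> \<le> 1/2" and ab: "a \<le> b" "b \<le> a + 1"
    and arc: "\<And>i. i \<in> J \<Longrightarrow> \<exists>k::int. x i + of_int k \<in> {a..b}"
    and T: "\<And>h::nat. 0 < h \<Longrightarrow> h < H \<Longrightarrow> cmod (\<Sum>i\<in>I. cis (2 * pi * real h * x i)) \<le> T * real (card I)"
    and T0: "0 \<le> T"
  shows "real (card J) / real (card I) \<le> (b - a) + (2 * \<eta> + 1 / (4 * real H * \<eta>\<^sup>2) + 2 * real H * T)"
proof -
  let ?n = "real (card I)" and ?\<tau> = "1 / (4 * real H * \<eta>\<^sup>2)" and ?A = "{a-\<eta>..b+\<eta>}"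
  have n: "0 < ?n" using I by (simp add: card_gt_0_iff)
  have int: "(\<lambda>t. fejer H (z - t)) integrable_on {u..v}" for u v z
    by (intro integrable_continuous_real continuous_intros)
  (* The integral over the enlarged arc sees the whole central peak of the kernel around each
     point that belongs to J. *)
  have hit: "1 - ?\<tau> \<le> integral ?A (\<lambda>t. fejer H (x i - t))" if i: "i \<in> J" for i
  proof -
    obtain k :: int where k: "x i + of_int k \<in> {a..b}" using arc[OF i] by blast
    define z where "z = x i + of_int k"
    have "fejer H (x i - t) = fejer H (z - t)" for t
      using fejer_add_int[of H "x i - t" k] by (simp add: z_def algebra_simps)
    then have "integral ?A (\<lambda>t. fejer H (x i - t)) = integral ?A (\<lambda>t. fejer H (z - t))" by simp
    also have "\<dots> \<ge> integral {z-\<eta>..z+\<eta>} (\<lambda>t. fejer H (z - t))"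
      using k \<eta> by (intro integral_subset_le int) (auto simp: z_def fejer_nonneg)
    also have "integral {z-\<eta>..z+\<eta>} (\<lambda>t. fejer H (z - t)) = integral {-\<eta>+z..\<eta>+z} (\<lambda>t. fejer H (z - t))"
      by (simp add: add.commute)
    also have "\<dots> = integral {-\<eta>..\<eta>} ((\<lambda>t. fejer H (z - t)) \<circ> (\<lambda>t. t + z))"
      by (intro integral_shift[symmetric] continuous_intros)
    also have "\<dots> = integral {-\<eta>..\<eta>} (fejer H)"
      by (simp add: o_def fejer_minus)
    also have "\<dots> \<ge> 1 - ?\<tau>" by (rule integral_fejer_centre[OF H \<eta>])
    finally show ?thesis .
  qed
  have "real (card J) * (1 - ?\<tau>) = (\<Sum>i\<in>J. 1 - ?\<tau>)" by simp
  also have "\<dots> \<le> (\<Sum>i\<in>J. integral ?A (\<lambda>t. fejer H (x i - t)))"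
    by (intro sum_mono hit)
  also have "\<dots> \<le> (\<Sum>i\<in>I. integral ?A (\<lambda>t. fejer H (x i - t)))"
    using I J by (intro sum_mono2) (auto intro!: Henstock_Kurzweil_Integration.integral_nonneg int fejer_nonneg)
  also have "\<dots> = integral ?A (\<lambda>t. \<Sum>i\<in>I. fejer H (x i - t))"
    using I by (intro integral_sum[symmetric] int)
  also have "\<dots> \<le> integral ?A (\<lambda>t. ?n + real H * (T * ?n))"
    using I T T0 H by (intro integral_le integrable_sum int sum_fejer_le) auto
  also have "\<dots> = (b - a + 2 * \<eta>) * (?n + real H * (T * ?n))"
    using ab \<eta> by simp
  finally have "real (card J) * (1 - ?\<tau>) \<le> ((b - a + 2 * \<eta>) * (1 + real H * T)) * ?n"
    by (simp add: algebra_simps)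
  then have main: "real (card J) / ?n * (1 - ?\<tau>) \<le> (b - a + 2 * \<eta>) * (1 + real H * T)"
    using n by (simp add: field_simps)
  have "real (card J) / ?n \<le> 1" using n card_mono[OF I(1) J] by simp
  then have "real (card J) / ?n * ?\<tau> \<le> 1 * ?\<tau>" by (rule mult_right_mono) simp
  moreover have "(b - a + 2 * \<eta>) * (real H * T) \<le> 2 * (real H * T)"
    using ab \<eta> T0 by (intro mult_right_mono) auto
  ultimately show ?thesis using main by (simp add: algebra_simps)
qed

lemma frequency_diff_le:
  fixes x :: "'a \<Rightarrow> real"
  assumes I: "finite I" "I \<noteq> {}" and H: "0 < H" and ab: "0 \<le> a" "a < b" "b \<le> 1"
    and T: "\<And>h::nat. 0 < h \<Longrightarrow> h < H \<Longrightarrow> cmod (\<Sum>i\<in>I. cis (2 * pi * real h * x i)) \<le> T * real (card I)"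
    and T0: "0 \<le> T"
  shows "\<bar>real (card {i\<in>I. frac (x i) \<in> {a..<b}}) / real (card I) - (b - a)\<bar>
     \<le> 2 * real H powr (-1/3) + 2 * real H * T"
proof -
  let ?n = "real (card I)" and ?J = "{i\<in>I. frac (x i) \<in> {a..<b}}"
  (* This radius balances the length 2 \<eta> gained by the arc against the kernel tail 1 / (4 H \<eta>^2):
     both become H^(-1/3). *)
  define \<eta> where "\<eta> = real H powr (-1/3) / 2"
  have n: "0 < ?n" using I by (simp add: card_gt_0_iff)
  have "real H powr (-1/3) \<le> real H powr 0" using H by (intro powr_mono) auto
  then have \<eta>: "0 < \<eta>" "\<eta> \<le> 1/2" using H by (auto simp: \<eta>_def)
  have "4 * real H * \<eta>\<^sup>2 = real H powr 1 * (real H powr (-1/3) * real H powr (-1/3))"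
    using H by (simp add: \<eta>_def power2_eq_square)
  also have "\<dots> = real H powr (1 + (-1/3 + -1/3))" by (simp only: powr_add)
  also have "\<dots> = real H powr (1/3)" by simp
  finally have "1 / (4 * real H * \<eta>\<^sup>2) = real H powr (-1/3)" by (simp add: powr_minus_divide)
  then have err: "2 * \<eta> + 1 / (4 * real H * \<eta>\<^sup>2) + 2 * real H * T = 2 * real H powr (-1/3) + 2 * real H * T"
    by (simp add: \<eta>_def)
  have "\<exists>k::int. x i + of_int k \<in> {a..b}" if "i \<in> ?J" for i
    using that by (intro exI[of _ "- \<lfloor>x i\<rfloor>"]) (auto simp: frac_def)
  from arc_count_le[where J = ?J, OF I _ H \<eta> _ _ this T T0, unfolded err] ab
  have up: "real (card ?J) / ?n \<le> (b - a) + (2 * real H powr (-1/3) + 2 * real H * T)" by auto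
  (* The points that miss [a,b) lie modulo 1 in the arc from b to a + 1, so that the upper bound
     for this arc is a lower bound for [a,b). *)
  have compl: "\<exists>k::int. x i + of_int k \<in> {b..a+1}" if "i \<in> I - ?J" for i
  proof (cases "frac (x i) < a")
    case True
    then show ?thesis using ab
      by (intro exI[of _ "1 - \<lfloor>x i\<rfloor>"]) (simp add: frac_def, linarith)
  next
    case False
    then have "b \<le> frac (x i)" using that by auto
    then show ?thesis using ab frac_lt_1[of "x i"]
      by (intro exI[of _ "- \<lfloor>x i\<rfloor>"]) (auto simp: frac_def)
  qed
  from arc_count_le[where J = "I - ?J", OF I _ H \<eta> _ _ this T T0, unfolded err] ab
  have low: "real (card (I - ?J)) / ?n \<le> (a + 1 - b) + (2 * real H powr (-1/3) + 2 * real H * T)" by auto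
  have "card I = card (I - ?J) + card ?J"
    using card_Diff_subset[of ?J I] card_mono[of I ?J] I by auto
  then have "real (card (I - ?J)) = ?n - real (card ?J)" by simp
  then have "real (card (I - ?J)) / ?n = 1 - real (card ?J) / ?n" using n by (simp add: field_simps)
  then show ?thesis using up low by linarith
qed

text \<open>Weyl's criterion, uniformly over all intervals. A tolerance \<open>\<epsilon>\<close> first fixes the cutoff \<open>H\<close>; then
  only finitely many exponential sums have to be small.\<close>

lemma weyl_criterion:
  fixes x :: "nat \<Rightarrow> 'a \<Rightarrow> real"
  assumes I: "\<And>N. finite (I N)" "\<And>N. I N \<noteq> {}"
    and lim: "\<And>h::nat. 0 < h \<Longrightarrow>
      (\<lambda>N. cmod (\<Sum>i\<in>I N. cis (2 * pi * real h * x N i)) / real (card (I N))) \<longlonglongrightarrow> 0"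
    and "0 < \<epsilon>"
  shows "\<forall>\<^sub>F N in sequentially. \<forall>a b. 0 \<le> a \<longrightarrow> a < b \<longrightarrow> b \<le> 1 \<longrightarrow>
     \<bar>real (card {i\<in>I N. frac (x N i) \<in> {a..<b}}) / real (card (I N)) - (b - a)\<bar> \<le> \<epsilon>"
proof -
  have "((\<lambda>H. 2 * real H powr (-1/3)) \<longlongrightarrow> 0) sequentially" by real_asymp
  then have "\<forall>\<^sub>F H in sequentially. 2 * real H powr (-1/3) < \<epsilon> / 2"
    by (rule order_tendstoD(2)) (use \<open>0 < \<epsilon>\<close> in simp)
  then have "\<forall>\<^sub>F H in sequentially. 2 * real H powr (-1/3) < \<epsilon> / 2 \<and> 0 < H"
    by (intro eventually_conj eventually_gt_at_top)
  from eventually_happens'[OF sequentially_bot this]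
  obtain H where H: "2 * real H powr (-1/3) < \<epsilon> / 2" "0 < H" by blast
  define T where "T = \<epsilon> / (4 * real H)"
  have T0: "0 < T" using H \<open>0 < \<epsilon>\<close> by (simp add: T_def)
  have "\<forall>\<^sub>F N in sequentially. cmod (\<Sum>i\<in>I N. cis (2 * pi * real h * x N i)) / real (card (I N)) < T"
    if "h \<in> {0<..<H}" for h
    using lim[of h] that T0 by (intro order_tendstoD(2)) auto
  then have "\<forall>\<^sub>F N in sequentially. \<forall>h\<in>{0<..<H}.
      cmod (\<Sum>i\<in>I N. cis (2 * pi * real h * x N i)) / real (card (I N)) < T"
    by (intro eventually_ball_finite) auto
  then show ?thesis
  proof eventually_elim
    case (elim N)
    have n: "0 < real (card (I N))" using I by (simp add: card_gt_0_iff)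
    have *: "cmod (\<Sum>i\<in>I N. cis (2 * pi * real h * x N i)) \<le> T * real (card (I N))"
      if "0 < h" "h < H" for h
    proof -
      have "cmod (\<Sum>i\<in>I N. cis (2 * pi * real h * x N i)) / real (card (I N)) < T"
        using elim that by auto
      then show ?thesis using n by (simp add: pos_divide_less_eq less_imp_le)
    qed
    have "2 * real H powr (-1/3) + 2 * real H * T \<le> \<epsilon>"
      using H by (simp add: T_def)
    then show ?case
      using frequency_diff_le[OF I(1) I(2) H(2) _ _ _ *] T0 by (meson less_imp_le order_trans)
  qed
qed

section \<open>Rational approximation\<close>

lemma dist_int_pos:
  fixes h :: nat and y :: real
  assumes "y \<notin> \<rat>" "0 < h"
  obtains d where "0 < d" "\<And>k::int. d \<le> \<bar>real h * y - of_int k\<bar>"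
proof
  have "real h * y \<noteq> of_int (round (real h * y))"
  proof
    assume *: "real h * y = of_int (round (real h * y))"
    have "y = real h * y / real h" using \<open>0 < h\<close> by simp
    also have "\<dots> = of_int (round (real h * y)) / real h" using * by simp
    also have "\<dots> \<in> \<rat>" by simp
    finally show False using assms by simp
  qed
  then show "0 < \<bar>real h * y - of_int (round (real h * y))\<bar>" by simp
  show "\<bar>real h * y - of_int (round (real h * y))\<bar> \<le> \<bar>real h * y - of_int k\<bar>" for k
    using round_diff_minimal[of "real h * y" k] by (simp add: abs_minus_commute)
qed

text \<open>This is how the irrationality exponent enters: above it, the inequality that defines it
  has finitely many solutions, so it fails for all fractions once a constant is allowed.\<close>

lemma irrational_approximation_ge:
  fixes y \<mu> :: real
  assumes y: "y \<notin> \<rat>" and \<mu>: "irrationality_exponent y < ereal \<mu>" "1 \<le> \<mu>"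
  obtains c where "0 < c"
    and "\<And>(q::nat) (a::int). 0 < q \<Longrightarrow> c * real q powr (1 - \<mu>) \<le> \<bar>real q * y - of_int a\<bar>"
proof -
  define F where "F = {(a::int, q::int). 0 < q \<and> coprime a q \<and>
       0 < \<bar>y - of_int a / of_int q\<bar> \<and> \<bar>y - of_int a / of_int q\<bar> < 1 / of_int q powr \<mu>}"
  have fin: "finite F"
  proof (rule ccontr)
    assume "infinite F"
    then have "ereal \<mu> \<le> irrationality_exponent y"
      unfolding irrationality_exponent_def F_def by (intro Sup_upper) auto
    then show False using \<mu>(1) by simp
  qed
  have ne: "y \<noteq> of_int a / of_int q" for a q :: int
    using y by (metis Rats_divide Rats_of_int)
  (* The finitely many exceptional fractions only lower the constant, and each leaves it positive
     because y is irrational. *)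
  define g where "g = (\<lambda>(a::int, q::int). \<bar>y - of_int a / of_int q\<bar> * of_int q powr \<mu>)"
  define c where "c = Min (insert 1 (g ` F))"
  have c: "0 < c"
    unfolding c_def using fin ne by (subst Min_gr_iff) (auto simp: g_def F_def)
  have cop: "c / of_int q powr \<mu> \<le> \<bar>y - of_int a / of_int q\<bar>" if "0 < q" "coprime a q" for a q :: int
  proof -
    have q: "0 < real_of_int q powr \<mu>" using that by simp
    have "c \<le> g (a, q)"
    proof (cases "(a, q) \<in> F")
      case True
      then show ?thesis unfolding c_def using fin by (intro Min_le) auto
    next
      case False
      then have "1 / of_int q powr \<mu> \<le> \<bar>y - of_int a / of_int q\<bar>"
        using that ne by (auto simp: F_def)
      then have "1 \<le> g (a, q)" using q by (simp add: g_def field_simps)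
      moreover have "c \<le> 1" unfolding c_def using fin by (intro Min_le) auto
      ultimately show ?thesis by linarith
    qed
    then show ?thesis using q by (simp add: g_def field_simps)
  qed
  have "c * real q powr (1 - \<mu>) \<le> \<bar>real q * y - of_int a\<bar>" if q: "0 < q" for q :: nat and a :: int
  proof -
    (* Reducing a / q to lowest terms shrinks the denominator and so strengthens the bound. *)
    define d where "d = gcd a (int q)"
    obtain a' q' where a': "a = a' * d" and q': "int q = q' * d" and co: "coprime a' q'"
      using gcd_coprime_exists[of a "int q"] q unfolding d_def by auto
    have d: "0 < d" using q by (simp add: d_def)
    then have q'0: "0 < q'" using q q' by (metis of_nat_0_less_iff zero_less_mult_pos2)
    have eq: "of_int a / real q = of_int a' / of_int q'"
    proof -
      have "real q = of_int q' * of_int d" using q' by (metis of_int_mult of_int_of_nat_eq)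
      then show ?thesis using d by (simp add: a')
    qed
    have "q' \<le> int q" using q' d q'0 by simp
    then have "of_int q' \<le> real q" by linarith
    then have "c / real q powr \<mu> \<le> c / of_int q' powr \<mu>"
      using c q'0 \<mu>(2) by (intro divide_left_mono powr_mono2) auto
    also have "\<dots> \<le> \<bar>y - of_int a / real q\<bar>" using cop[OF q'0 co] by (simp add: eq)
    finally have "c / real q powr \<mu> * real q \<le> \<bar>y - of_int a / real q\<bar> * real q"
      by (rule mult_right_mono) simp
    moreover have "\<bar>y - of_int a / real q\<bar> * real q = \<bar>real q * y - of_int a\<bar>"
      using q by (simp add: abs_mult_pos' abs_mult_pos field_simps)
    ultimately show ?thesis using q by (simp add: powr_diff)
  qed
  then show thesis using that c by blast
qed

lemma common_denominator:
  fixes y :: "'a \<Rightarrow> real"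
  assumes "finite A" "\<And>i. i \<in> A \<Longrightarrow> y i \<in> \<rat>"
  obtains h :: nat where "0 < h" "\<And>i. i \<in> A \<Longrightarrow> real h * y i \<in> \<int>"
  using assms
proof (induction A arbitrary: thesis rule: finite_induct)
  case empty
  show ?case by (rule empty.prems(1)[of 1]) auto
next
  case (insert a A)
  obtain h where h: "0 < h" "\<And>i. i \<in> A \<Longrightarrow> real h * y i \<in> \<int>"
    using insert.IH insert.prems(2) by blast
  obtain q :: nat where q: "0 < q" "real q * y a \<in> \<int>"
  proof -
    obtain u v :: int where uv: "0 < v" "y a = of_int u / of_int v"
      using insert.prems(2)[of a] by (auto elim!: Rats_cases')
    then have "real (nat v) * y a = of_int u" by simp
    then show thesis using that[of "nat v"] uv by simp
  qed
  show ?case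
  proof (rule insert.prems(1)[of "h * q"])
    show "0 < h * q" using h q by simp
    fix i assume "i \<in> insert a A"
    then consider "i = a" | "i \<in> A" by blast
    then show "real (h * q) * y i \<in> \<int>"
    proof cases
      case 1
      have eq: "real (h * q) * y a = real h * (real q * y a)" by simp
      show ?thesis unfolding 1 eq by (rule Ints_mult[OF Ints_of_nat q(2)])
    next
      case 2
      have eq: "real (h * q) * y i = real q * (real h * y i)" by simp
      show ?thesis unfolding eq by (rule Ints_mult[OF Ints_of_nat h(2)[OF 2]])
    qed
  qed
qed

section \<open>Exponential sums over the sticks\<close>

lemma sticks_pos:
  assumes "0 < L" "\<And>i. i \<in> {1..m} \<Longrightarrow> 0 < p i" "x \<in> set (sticks m p L N)"
  shows "0 < x"
  using assms by (auto simp: set_sticks intro!: mult_pos_pos prod_pos)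

text \<open>The function \<open>x \<mapsto> cis (2 * pi * h * log b x)\<close> is a multiplicative character of the positive
  reals. Cutting every stick therefore multiplies its sum over all sticks by one and the same
  factor, the sum over the proportions.\<close>

lemma sum_list_sticks_character:
  assumes L: "0 < L" and p: "\<And>i. i \<in> {1..m} \<Longrightarrow> 0 < p i"
  shows "(\<Sum>x\<leftarrow>sticks m p L N. cis (2 * pi * h * log b x))
       = (\<Sum>i=1..m. cis (2 * pi * h * log b (p i))) ^ N * cis (2 * pi * h * log b L)"
proof (induction N)
  case 0
  show ?case by simp
next
  case (Suc N)
  let ?\<chi> = "\<lambda>x. cis (2 * pi * h * log b x)" and ?S = "\<Sum>i=1..m. cis (2 * pi * h * log b (p i))"
  have one: "(\<Sum>z\<leftarrow>map (\<lambda>i. p i * x) [1..<Suc m]. ?\<chi> z) = ?S * ?\<chi> x" if x: "0 < x" for x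
  proof -
    have "(\<Sum>z\<leftarrow>map (\<lambda>i. p i * x) [1..<Suc m]. ?\<chi> z) = (\<Sum>i=1..m. ?\<chi> (p i * x))"
      by (simp add: o_def interv_sum_list_conv_sum_set_nat atLeastLessThanSuc_atLeastAtMost del: upt_Suc)
    also have "\<dots> = (\<Sum>i=1..m. ?\<chi> (p i) * ?\<chi> x)"
    proof (intro sum.cong refl)
      fix i assume "i \<in> {1..m}"
      then have "log b (p i * x) = log b (p i) + log b x"
        using p[of i] x by (simp add: log_mult)
      then show "?\<chi> (p i * x) = ?\<chi> (p i) * ?\<chi> x" by (simp add: cis_mult algebra_simps)
    qed
    finally show ?thesis by (simp add: sum_distrib_right)
  qed
  have "(\<Sum>x\<leftarrow>sticks m p L (Suc N). ?\<chi> x)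
      = (\<Sum>x\<leftarrow>sticks m p L N. \<Sum>z\<leftarrow>map (\<lambda>i. p i * x) [1..<Suc m]. ?\<chi> z)"
  proof -
    have "(\<Sum>x\<leftarrow>concat (map g xs). ?\<chi> x) = (\<Sum>x\<leftarrow>xs. \<Sum>z\<leftarrow>g x. ?\<chi> z)" for g :: "real \<Rightarrow> real list" and xs
      by (induction xs) auto
    then show ?thesis by (simp only: sticks.simps)
  qed
  also have "\<dots> = (\<Sum>x\<leftarrow>sticks m p L N. ?S * ?\<chi> x)"
    by (intro arg_cong[of _ _ sum_list] map_cong refl one) (rule sticks_pos[OF L p])
  also have "\<dots> = ?S * (\<Sum>x\<leftarrow>sticks m p L N. ?\<chi> x)" by (simp add: sum_list_const_mult)
  finally show ?case using Suc by (simp add: mult.assoc)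
qed

lemma norm_sum_sticks_character:
  assumes L: "0 < L" and p: "\<And>i. i \<in> {1..m} \<Longrightarrow> 0 < p i"
  shows "cmod (\<Sum>j<m ^ N. cis (2 * pi * h * log b (sticks m p L N ! j)))
       = cmod (\<Sum>i=1..m. cis (2 * pi * h * log b (p i))) ^ N"
proof -
  have "(\<Sum>j<m ^ N. cis (2 * pi * h * log b (sticks m p L N ! j)))
      = (\<Sum>x\<leftarrow>sticks m p L N. cis (2 * pi * h * log b x))"
    by (simp add: sum_list_sum_nth length_sticks atLeast0LessThan)
  also have "\<dots> = (\<Sum>i=1..m. cis (2 * pi * h * log b (p i))) ^ N * cis (2 * pi * h * log b L)"
    by (rule sum_list_sticks_character[OF L p])
  finally show ?thesis by (simp add: norm_mult norm_power)
qed

text \<open>Two unit vectors whose directions differ lose a definite part of their sum by the parallelogram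
  law; the other \<open>m - 2\<close> vectors are estimated trivially.\<close>

lemma norm_sum_cis_le:
  fixes l :: "nat \<Rightarrow> real"
  assumes i: "i \<in> {1..m - 1}" and d: "0 \<le> d" "\<And>k::int. d \<le> \<bar>l i - l (i + 1) - of_int k\<bar>"
  shows "cmod (\<Sum>j=1..m. cis (2 * pi * l j)) \<le> real m - 4 * d\<^sup>2"
proof -
  let ?u = "cis (2 * pi * l i)" and ?v = "cis (2 * pi * l (i + 1))"
  have "?u = ?v * cis (2 * pi * (l i - l (i + 1)))"
    unfolding cis_mult by (rule arg_cong[of _ _ cis]) (simp add: algebra_simps)
  then have "?u - ?v = ?v * (cis (2 * pi * (l i - l (i + 1))) - 1)"
    by (simp only: right_diff_distrib mult_1_right)
  then have "cmod (?u - ?v) = cmod (cis (2 * pi * (l i - l (i + 1))) - 1)"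
    by (simp add: norm_mult)
  then have uv: "4 * d \<le> cmod (?u - ?v)"
    using norm_cis_diff_one_ge[of d "l i - l (i + 1)"] d by simp
  have "cmod (?u - ?v) \<le> 2" using norm_triangle_ineq4[of ?u ?v] by simp
  then have d1: "d \<le> 1/2" using uv by linarith
  have "(cmod (?u + ?v))\<^sup>2 + (cmod (?u - ?v))\<^sup>2 = 4"
  proof -
    have "(cmod (u + v))\<^sup>2 + (cmod (u - v))\<^sup>2 = 2 * (cmod u)\<^sup>2 + 2 * (cmod v)\<^sup>2" for u v :: complex
      unfolding cmod_power2 by (simp add: power2_eq_square algebra_simps)
    from this[of ?u ?v] show ?thesis by simp
  qed
  moreover have "(4 * d)\<^sup>2 \<le> (cmod (?u - ?v))\<^sup>2" using uv d by (intro power_mono) auto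
  ultimately have "(cmod (?u + ?v))\<^sup>2 \<le> 4 - 16 * d\<^sup>2" by (simp add: power_mult_distrib)
  also have "\<dots> \<le> (2 - 4 * d\<^sup>2)\<^sup>2"
    using zero_le_power2[of "4 * d\<^sup>2"] by (simp add: power2_diff power_mult_distrib)
  finally have "(cmod (?u + ?v))\<^sup>2 \<le> (2 - 4 * d\<^sup>2)\<^sup>2" .
  moreover have "0 \<le> 2 - 4 * d\<^sup>2"
    using power_mono[OF d1 d(1), of 2] by (simp add: power2_eq_square)
  ultimately have pair: "cmod (?u + ?v) \<le> 2 - 4 * d\<^sup>2" by (rule power2_le_imp_le)
  have sub: "{i, i + 1} \<subseteq> {1..m}" using i by auto
  have "(\<Sum>j=1..m. cis (2 * pi * l j)) = (\<Sum>j\<in>{1..m} - {i, i + 1}. cis (2 * pi * l j)) + (?u + ?v)"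
    by (subst sum.subset_diff[OF sub]) auto
  also have "cmod \<dots> \<le> (\<Sum>j\<in>{1..m} - {i, i + 1}. cmod (cis (2 * pi * l j))) + (2 - 4 * d\<^sup>2)"
    by (intro norm_triangle_mono norm_sum pair)
  also have "(\<Sum>j\<in>{1..m} - {i, i + 1}. cmod (cis (2 * pi * l j))) = real (card ({1..m} - {i, i + 1}))"
    by simp
  also have "card ({1..m} - {i, i + 1}) = m - 2"
    using sub by (subst card_Diff_subset) auto
  also have "real (m - 2) + (2 - 4 * d\<^sup>2) = real m - 4 * d\<^sup>2"
    using i by (auto simp: of_nat_diff)
  finally show ?thesis .
qed

lemma norm_sticks_character_le:
  assumes b: "0 < b" "b \<noteq> 1" and L: "0 < L" and p: "\<And>i. i \<in> {1..m} \<Longrightarrow> 0 < p i"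
    and i: "i \<in> {1..m - 1}"
    and d: "0 \<le> d" "\<And>k::int. d \<le> \<bar>h * log b (p i / p (i + 1)) - of_int k\<bar>"
  shows "cmod (\<Sum>j<m ^ N. cis (2 * pi * h * log b (sticks m p L N ! j)))
       \<le> exp (- 4 * d\<^sup>2 / real m * real N) * real (m ^ N)"
proof -
  have m: "0 < real m" using i by auto
  have "0 < p i" "0 < p (i + 1)" using p i by auto
  then have "h * log b (p i) - h * log b (p (i + 1)) = h * log b (p i / p (i + 1))"
    using b by (subst log_divide) (auto simp: algebra_simps)
  then have "cmod (\<Sum>j=1..m. cis (2 * pi * (h * log b (p j)))) \<le> real m - 4 * d\<^sup>2"
    using d by (intro norm_sum_cis_le[OF i]) auto
  also have "\<dots> = real m * (1 + (- 4 * d\<^sup>2 / real m))" using m by (simp add: field_simps)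
  also have "\<dots> \<le> real m * exp (- 4 * d\<^sup>2 / real m)"
    using m by (intro mult_left_mono exp_ge_add_one_self) auto
  finally have "cmod (\<Sum>j=1..m. cis (2 * pi * h * log b (p j))) ^ N \<le> (real m * exp (- 4 * d\<^sup>2 / real m)) ^ N"
    by (intro power_mono) (auto simp: mult.assoc)
  also have "\<dots> = exp (- 4 * d\<^sup>2 / real m * real N) * real (m ^ N)"
    by (simp add: power_mult_distrib mult.commute flip: exp_of_nat_mult)
  finally show ?thesis using norm_sum_sticks_character[OF L p] by simp
qed

section \<open>Benford behaviour as equidistribution of logarithms\<close>

lemma significand_eq_powr_frac:
  assumes "2 \<le> B" "0 < x"
  shows "significand B x = real B powr frac (log (real B) x)"
proof -
  have B: "real B > 1" using assms by simp
  let ?l = "log (real B) x"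
  have "1 \<le> real B powr frac ?l" using B by (simp add: ge_one_powr_ge_zero)
  moreover have "real B powr frac ?l < real B"
    using powr_less_mono[OF frac_lt_1[of ?l] B] B by simp
  moreover have "x = real B powr frac ?l * real B powi \<lfloor>?l\<rfloor>"
  proof -
    have "x = real B powr (frac ?l + of_int \<lfloor>?l\<rfloor>)" using assms B by (simp add: frac_def)
    then show ?thesis using B by (simp add: powr_add powr_real_of_int')
  qed
  ultimately show ?thesis
    unfolding significand_def by (intro the1_equality significand_unique assms) blast
qed

lemma significand_le_iff:
  assumes "2 \<le> B" "0 < x" "0 < s"
  shows "significand B x \<le> s \<longleftrightarrow> frac (log (real B) x) \<le> log (real B) s"
  using assms by (simp add: significand_eq_powr_frac le_log_iff)

lemma strong_benford_uniform_iff: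
  fixes X :: "nat \<Rightarrow> nat \<Rightarrow> real"
  assumes B: "2 \<le> B" and n: "\<And>N. 0 < n N" and X: "\<And>N j. j < n N \<Longrightarrow> 0 < X N j"
  shows "strong_benford B (\<lambda>N. uniform_count_measure {..<n N}) X \<longleftrightarrow>
    (\<forall>\<sigma>. 0 \<le> \<sigma> \<longrightarrow> \<sigma> < 1 \<longrightarrow>
      (\<lambda>N. real (card {j\<in>{..<n N}. frac (log (real B) (X N j)) \<le> \<sigma>}) / real (n N)) \<longlonglongrightarrow> \<sigma>)"
    (is "_ \<longleftrightarrow> (\<forall>\<sigma>. 0 \<le> \<sigma> \<longrightarrow> \<sigma> < 1 \<longrightarrow> ?F \<sigma> \<longlonglongrightarrow> \<sigma>)")
proof -
  have B1: "1 < real B" using B by simp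
  have meas: "measure (uniform_count_measure {..<n N})
      {\<omega> \<in> space (uniform_count_measure {..<n N}). significand B (X N \<omega>) \<le> s} = ?F (log (real B) s) N"
    if "1 \<le> s" for N s
  proof -
    have "{\<omega> \<in> space (uniform_count_measure {..<n N}). significand B (X N \<omega>) \<le> s}
        = {j\<in>{..<n N}. frac (log (real B) (X N j)) \<le> log (real B) s}"
      using that X B by (auto simp: space_uniform_count_measure significand_le_iff)
    then show ?thesis by (subst measure_uniform_count_measure) auto
  qed
  have "prob_space (uniform_count_measure {..<n N})" for N
    using n[of N] by (intro prob_space_uniform_count_measure) auto
  moreover have "X N \<in> borel_measurable (uniform_count_measure {..<n N})" for N
    by (auto simp: measurable_def space_uniform_count_measure sets_uniform_count_measure)
  ultimately have "strong_benford B (\<lambda>N. uniform_count_measure {..<n N}) X \<longleftrightarrow>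
      (\<forall>s. 1 \<le> s \<and> s < real B \<longrightarrow>
        (\<lambda>N. measure (uniform_count_measure {..<n N})
          {\<omega> \<in> space (uniform_count_measure {..<n N}). significand B (X N \<omega>) \<le> s}) \<longlonglongrightarrow> log (real B) s)"
    using X unfolding strong_benford_def by (simp add: space_uniform_count_measure)
  also have "\<dots> \<longleftrightarrow> (\<forall>s. 1 \<le> s \<and> s < real B \<longrightarrow> ?F (log (real B) s) \<longlonglongrightarrow> log (real B) s)"
    by (simp only: meas cong: imp_cong)
  also have "\<dots> \<longleftrightarrow> (\<forall>\<sigma>. 0 \<le> \<sigma> \<longrightarrow> \<sigma> < 1 \<longrightarrow> ?F \<sigma> \<longlonglongrightarrow> \<sigma>)"
  proof safe
    fix \<sigma> :: real
    assume F: "\<forall>s. 1 \<le> s \<and> s < real B \<longrightarrow> ?F (log (real B) s) \<longlonglongrightarrow> log (real B) s"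
      and \<sigma>: "0 \<le> \<sigma>" "\<sigma> < 1"
    have "1 \<le> real B powr \<sigma>" using B1 \<sigma> by (simp add: ge_one_powr_ge_zero)
    moreover have "real B powr \<sigma> < real B" using powr_less_mono[OF \<sigma>(2) B1] B1 by simp
    ultimately show "?F \<sigma> \<longlonglongrightarrow> \<sigma>" using F[rule_format, of "real B powr \<sigma>"] B1 by simp
  next
    fix s :: real
    assume F: "\<forall>\<sigma>. 0 \<le> \<sigma> \<longrightarrow> \<sigma> < 1 \<longrightarrow> ?F \<sigma> \<longlonglongrightarrow> \<sigma>" and s: "1 \<le> s" "s < real B"
    then show "?F (log (real B) s) \<longlonglongrightarrow> log (real B) s" using B1 by simp
  qed
  finally show ?thesis .
qed

section \<open>Benford behaviour of the sticks\<close>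

text \<open>For an irrational ratio no positive multiple \<open>h\<close> of its logarithm is an integer, so every
  nontrivial exponential sum decays exponentially in \<open>N\<close> and Weyl's criterion applies.\<close>

lemma irrational_imp_benford:
  assumes B: "2 \<le> B" and L: "0 < L" and p: "\<And>i. i \<in> {1..m} \<Longrightarrow> 0 < p i"
    and i: "i \<in> {1..m - 1}" and irr: "log (real B) (p i / p (i + 1)) \<notin> \<rat>"
  shows "strong_benford B (\<lambda>N. uniform_count_measure {..<m ^ N}) (\<lambda>N j. sticks m p L N ! j)"
proof -
  let ?x = "\<lambda>N j. log (real B) (sticks m p L N ! j)"
  let ?G = "\<lambda>N S. real (card {j\<in>{..<m ^ N}. frac (?x N j) \<in> S}) / real (m ^ N)"
  have m: "0 < m" using i by auto
  have pos: "0 < sticks m p L N ! j" if "j < m ^ N" for N j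
    by (rule sticks_pos[where N = N, OF L p]) (use that in \<open>auto simp: length_sticks\<close>)
  have B1: "0 < real B" "real B \<noteq> 1" using B by auto
  have lim: "(\<lambda>N. cmod (\<Sum>j\<in>{..<m ^ N}. cis (2 * pi * real h * ?x N j)) / real (m ^ N)) \<longlonglongrightarrow> 0"
    if "0 < h" for h :: nat
  proof -
    obtain d where d: "0 < d" "\<And>k::int. d \<le> \<bar>real h * log (real B) (p i / p (i + 1)) - of_int k\<bar>"
      using dist_int_pos[OF irr \<open>0 < h\<close>] by metis
    define c where "c = 4 * d\<^sup>2 / real m"
    have "0 < c" using d m by (simp add: c_def)
    then have "(\<lambda>N. exp (- c * real N)) \<longlonglongrightarrow> 0" by real_asymp
    moreover have "cmod (\<Sum>j<m ^ N. cis (2 * pi * real h * ?x N j)) / real (m ^ N) \<le> exp (- c * real N)" for N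
    proof -
      have "cmod (\<Sum>j<m ^ N. cis (2 * pi * real h * ?x N j)) \<le> exp (- 4 * d\<^sup>2 / real m * real N) * real (m ^ N)"
        using d by (intro norm_sticks_character_le[OF B1 L p i]) auto
      moreover have "0 < real (m ^ N)" using m by simp
      ultimately show ?thesis by (simp add: c_def pos_divide_le_eq)
    qed
    ultimately show ?thesis
      by (intro tendsto_sandwich[OF _ _ tendsto_const \<open>(\<lambda>N. exp (- c * real N)) \<longlonglongrightarrow> 0\<close>]) auto
  qed
  have "(\<lambda>N. ?G N {..\<sigma>}) \<longlonglongrightarrow> \<sigma>" if \<sigma>: "0 \<le> \<sigma>" "\<sigma> < 1" for \<sigma>
  proof (rule tendstoI)
    fix e :: real assume "0 < e"
    define \<epsilon> where "\<epsilon> = e / 3"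
    have e: "0 < \<epsilon>" "2 * \<epsilon> < e" using \<open>0 < e\<close> by (auto simp: \<epsilon>_def)
    have "{..<m ^ N} \<noteq> {}" for N using m by (auto simp: lessThan_empty_iff)
    then have "\<forall>\<^sub>F N in sequentially. \<forall>a b. 0 \<le> a \<longrightarrow> a < b \<longrightarrow> b \<le> 1 \<longrightarrow> \<bar>?G N {a..<b} - (b - a)\<bar> \<le> \<epsilon>"
      by (intro weyl_criterion[where I = "\<lambda>N. {..<m ^ N}" and x = ?x, unfolded card_lessThan] lim e finite_lessThan)
    then show "\<forall>\<^sub>F N in sequentially. dist (?G N {..\<sigma>}) \<sigma> < e"
    proof eventually_elim
      case (elim N)
      have mono: "?G N S \<le> ?G N S'" if "\<And>v. v \<in> S \<Longrightarrow> 0 \<le> v \<Longrightarrow> v < 1 \<Longrightarrow> v \<in> S'" for S S'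
      proof -
        have "frac z \<in> S \<Longrightarrow> frac z \<in> S'" for z :: real
          using that[of "frac z"] by (simp add: frac_lt_1)
        then show ?thesis by (intro divide_right_mono of_nat_mono card_mono) auto
      qed
      (* The interval {..\<sigma>} is closed, the counted ones are half-open: it lies between
         {0..<\<sigma>} and the slightly longer {0..<\<sigma>'}. *)
      define \<sigma>' where "\<sigma>' = min (\<sigma> + \<epsilon>) 1"
      have \<sigma>': "\<sigma> < \<sigma>'" "\<sigma>' \<le> 1" "\<sigma>' \<le> \<sigma> + \<epsilon>" using \<sigma> e by (auto simp: \<sigma>'_def)
      have "?G N {..\<sigma>} \<le> ?G N {0..<\<sigma>'}" using \<sigma>' by (intro mono) auto
      moreover have "\<bar>?G N {0..<\<sigma>'} - (\<sigma>' - 0)\<bar> \<le> \<epsilon>"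
        by (rule elim[rule_format]) (use \<sigma> \<sigma>' in auto)
      ultimately have up: "?G N {..\<sigma>} \<le> \<sigma> + 2 * \<epsilon>" using \<sigma>' by linarith
      have low: "\<sigma> - \<epsilon> \<le> ?G N {..\<sigma>}"
      proof (cases "\<sigma> = 0")
        case True
        have "0 \<le> ?G N {..\<sigma>}" by (intro divide_nonneg_nonneg) auto
        then show ?thesis using True e by linarith
      next
        case False
        have "?G N {0..<\<sigma>} \<le> ?G N {..\<sigma>}" by (intro mono) auto
        moreover have "\<bar>?G N {0..<\<sigma>} - (\<sigma> - 0)\<bar> \<le> \<epsilon>"
          by (rule elim[rule_format]) (use \<sigma> False in auto)
        ultimately show ?thesis by linarith
      qed
      show ?case using up low e unfolding dist_real_def abs_less_iff by linarith
    qed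
  qed
  then show ?thesis
    using m pos by (subst strong_benford_uniform_iff[OF B]) auto
qed

text \<open>If \<open>h\<close> clears the denominators of all logarithmic ratios, then exchanging one proportion for
  another moves \<open>h * log b x\<close> by an integer. All sticks of one stage then agree modulo 1 in this
  quantity, which is what obstructs equidistribution.\<close>

lemma sticks_log_cong:
  assumes b: "0 < b" "b \<noteq> 1" and L: "0 < L" and p: "\<And>i. i \<in> {1..m} \<Longrightarrow> 0 < p i"
    and h: "\<And>i. i \<in> {1..m - 1} \<Longrightarrow> h * log b (p i / p (i + 1)) \<in> \<int>"
  shows "x \<in> set (sticks m p L N) \<Longrightarrow> h * log b x - h * (log b L + real N * log b (p 1)) \<in> \<int>"
proof (induction N arbitrary: x)
  case 0
  then show ?case by simp
next
  case (Suc N)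
  have step: "h * log b (p i) - h * log b (p 1) \<in> \<int>" if "1 \<le> i" "i \<le> m" for i
    using that
  proof (induction i rule: dec_induct)
    case base
    show ?case by simp
  next
    case (step i)
    then have i: "i \<in> {1..m - 1}" by auto
    have "0 < p i" "0 < p (i + 1)" using p i by auto
    then have "h * log b (p i / p (i + 1)) = h * log b (p i) - h * log b (p (Suc i))"
      using b by (subst log_divide) (auto simp: algebra_simps)
    then have eq: "h * log b (p (Suc i)) - h * log b (p 1)
        = (h * log b (p i) - h * log b (p 1)) - h * log b (p i / p (i + 1))" by simp
    show ?case unfolding eq by (rule Ints_diff[OF _ h[OF i]]) (use step in simp)
  qed
  from Suc.prems obtain z i where z: "z \<in> set (sticks m p L N)" and i: "i \<in> {1..m}" and x: "x = p i * z"
    by (force simp del: upt_Suc)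
  have "log b x = log b (p i) + log b z"
    using p[OF i] sticks_pos[OF L p z] by (simp add: x log_mult)
  then have "h * log b x - h * (log b L + real (Suc N) * log b (p 1))
      = (h * log b (p i) - h * log b (p 1)) + (h * log b z - h * (log b L + real N * log b (p 1)))"
    by (simp add: algebra_simps)
  then show ?case using Ints_add[OF step Suc.IH[OF z]] i by simp
qed

text \<open>At each stage the logarithms occupy at most \<open>h\<close> points modulo 1, but these points may
  drift with \<open>N\<close>, so no fixed interval need stay empty. Two disjoint test intervals, no translate by
  a multiple of \<open>1/h\<close> of the first meeting the second, cannot both be hit at the same stage; Benford
  behaviour would hit both at all large stages.\<close>

lemma rational_imp_not_benford:
  assumes B: "2 \<le> B" and L: "0 < L" and p: "\<And>i. i \<in> {1..m} \<Longrightarrow> 0 < p i" and m: "0 < m"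
    and rat: "\<And>i. i \<in> {1..m - 1} \<Longrightarrow> log (real B) (p i / p (i + 1)) \<in> \<rat>"
  shows "\<not> strong_benford B (\<lambda>N. uniform_count_measure {..<m ^ N}) (\<lambda>N j. sticks m p L N ! j)"
proof
  assume "strong_benford B (\<lambda>N. uniform_count_measure {..<m ^ N}) (\<lambda>N j. sticks m p L N ! j)"
  let ?x = "\<lambda>N j. log (real B) (sticks m p L N ! j)"
  let ?J = "\<lambda>\<sigma> N. {j\<in>{..<m ^ N}. frac (?x N j) \<le> \<sigma>}"
  let ?F = "\<lambda>\<sigma> N. real (card (?J \<sigma> N)) / real (m ^ N)"
  have pos: "0 < sticks m p L N ! j" if "j < m ^ N" for N j
    by (rule sticks_pos[where N = N, OF L p]) (use that in \<open>auto simp: length_sticks\<close>)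
  have F: "?F \<sigma> \<longlonglongrightarrow> \<sigma>" if "0 \<le> \<sigma>" "\<sigma> < 1" for \<sigma>
  proof -
    have "\<forall>\<sigma>. 0 \<le> \<sigma> \<longrightarrow> \<sigma> < 1 \<longrightarrow> ?F \<sigma> \<longlonglongrightarrow> \<sigma>"
      using \<open>strong_benford _ _ _\<close> m pos
      by (subst (asm) strong_benford_uniform_iff[OF B]) auto
    then show ?thesis using that by blast
  qed
  have B1: "0 < real B" "real B \<noteq> 1" using B by auto
  obtain h :: nat where h: "0 < h" "\<And>i. i \<in> {1..m - 1} \<Longrightarrow> real h * log (real B) (p i / p (i + 1)) \<in> \<int>"
    using common_denominator[of "{1..m - 1}" "\<lambda>i. log (real B) (p i / p (i + 1))"] rat by blast
  have same: "frac (real h * ?x N j) = frac (real h * (log (real B) L + real N * log (real B) (p 1)))"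
    if "j < m ^ N" for N j
  proof -
    have "sticks m p L N ! j \<in> set (sticks m p L N)" using that by (simp add: length_sticks)
    from sticks_log_cong[OF B1 L p h(2) this]
    obtain k where "real h * ?x N j = real h * (log (real B) L + real N * log (real B) (p 1)) + of_int k"
      by (auto elim!: Ints_cases simp: algebra_simps)
    then show ?thesis by (simp add: frac_def)
  qed
  have hit: "\<forall>\<^sub>F N in sequentially. \<exists>j<m ^ N. \<sigma> / real h < frac (?x N j) \<and> frac (?x N j) \<le> \<tau> / real h"
    if "0 \<le> \<sigma>" "\<sigma> < \<tau>" "\<tau> < 1" for \<sigma> \<tau>
  proof -
    have h1: "1 \<le> real h" using h by simp
    have "\<tau> / real h \<le> \<tau> / 1" using that h1 by (intro divide_left_mono) auto
    then have st: "0 \<le> \<sigma> / real h" "\<sigma> / real h < \<tau> / real h" "\<tau> / real h < 1"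
      using that h by (auto simp: divide_strict_right_mono)
    then have "(\<lambda>N. ?F (\<tau> / real h) N - ?F (\<sigma> / real h) N) \<longlonglongrightarrow> \<tau> / real h - \<sigma> / real h"
      by (intro tendsto_diff F) auto
    then have "\<forall>\<^sub>F N in sequentially. 0 < ?F (\<tau> / real h) N - ?F (\<sigma> / real h) N"
      by (rule order_tendstoD(1)) (use st in simp)
    then show ?thesis
    proof eventually_elim
      case (elim N)
      show ?case
      proof (rule ccontr)
        assume "\<not> ?thesis"
        then have "?J (\<tau> / real h) N \<subseteq> ?J (\<sigma> / real h) N" by force
        then have "card (?J (\<tau> / real h) N) \<le> card (?J (\<sigma> / real h) N)" by (intro card_mono) auto
        then have "?F (\<tau> / real h) N \<le> ?F (\<sigma> / real h) N" by (intro divide_right_mono) auto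
        then show False using elim by linarith
      qed
    qed
  qed
  (* Multiplication by h carries the two test intervals (0, 1/(3h)] and (1/(2h), 2/(3h)] to the
     disjoint intervals (0, 1/3] and (1/2, 2/3]. *)
  have scale: "\<sigma> < frac (real h * v) \<and> frac (real h * v) \<le> \<tau>"
    if "\<sigma> / real h < frac v" "frac v \<le> \<tau> / real h" "0 \<le> \<sigma>" "\<tau> < 1" for \<sigma> \<tau> v
  proof -
    have "\<sigma> < real h * frac v" "real h * frac v \<le> \<tau>" using that h by (simp_all add: field_simps)
    moreover have "frac (real h * v) = real h * frac v"
    proof -
      have "real h * v - real h * frac v = of_int (int h * \<lfloor>v\<rfloor>)" by (simp add: frac_def algebra_simps)
      then show ?thesis unfolding frac_unique_iff using calculation that by (auto simp del: of_int_mult)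
    qed
    ultimately show ?thesis by simp
  qed
  from eventually_happens'[OF sequentially_bot eventually_conj[OF hit[of 0 "1/3"] hit[of "1/2" "2/3"]]]
  obtain N i j where i: "i < m ^ N" "0 / real h < frac (?x N i)" "frac (?x N i) \<le> (1/3) / real h"
    and j: "j < m ^ N" "(1/2) / real h < frac (?x N j)" "frac (?x N j) \<le> (2/3) / real h"
    by auto
  show False using scale[OF i(2,3)] scale[OF j(2,3)] same[OF i(1)] same[OF j(1)] by simp
qed

section \<open>Discrepancy of the sticks\<close>

lemma discrepancy_sticks_le:
  assumes B: "2 \<le> B" and L: "0 < L" and p: "\<And>i. i \<in> {1..m} \<Longrightarrow> 0 < p i" and m: "0 < m"
    and H: "0 < H" and T0: "0 \<le> T"
    and T: "\<And>h::nat. 0 < h \<Longrightarrow> h < H \<Longrightarrow>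
      cmod (\<Sum>j<m ^ N. cis (2 * pi * real h * log (real B) (sticks m p L N ! j))) \<le> T * real (m ^ N)"
  shows "\<bar>discrepancy (map (log (real B)) (sticks m p L N))\<bar> \<le> 2 * real H powr (-1/3) + 2 * real H * T"
proof -
  let ?xs = "map (log (real B)) (sticks m p L N)"
  have set: "{i. i < length ?xs \<and> frac (?xs ! i) \<in> {a..<b}}
      = {j\<in>{..<m ^ N}. frac (log (real B) (sticks m p L N ! j)) \<in> {a..<b}}" for a b
    by (auto simp: length_sticks)
  show ?thesis
    unfolding discrepancy_def
  proof (rule cSup_abs_le)
    have "(0::real, 1::real) \<in> {(a, b). 0 \<le> a \<and> a < b \<and> b \<le> 1}" by simp
    then show "(\<lambda>(a, b). \<bar>real (card {i. i < length ?xs \<and> frac (?xs ! i) \<in> {a..<b}}) / real (length ?xs) - (b - a)\<bar>)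
        ` {(a, b). 0 \<le> a \<and> a < b \<and> b \<le> 1} \<noteq> {}" by blast
  next
    fix z assume "z \<in> (\<lambda>(a, b). \<bar>real (card {i. i < length ?xs \<and> frac (?xs ! i) \<in> {a..<b}}) / real (length ?xs) - (b - a)\<bar>)
        ` {(a, b). 0 \<le> a \<and> a < b \<and> b \<le> 1}"
    then obtain a b where ab: "0 \<le> a" "a < b" "b \<le> 1"
      and z: "z = \<bar>real (card {i. i < length ?xs \<and> frac (?xs ! i) \<in> {a..<b}}) / real (length ?xs) - (b - a)\<bar>"
      by auto
    have "z \<le> 2 * real H powr (-1/3) + 2 * real H * T"
      using frequency_diff_le[of "{..<m ^ N}" H a b "\<lambda>j. log (real B) (sticks m p L N ! j)" T] H ab T T0 m
      unfolding z set by (auto simp: length_sticks lessThan_empty_iff simp del: atLeastLessThan_iff)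
    then show "\<bar>z\<bar> \<le> 2 * real H powr (-1/3) + 2 * real H * T" unfolding z by simp
  qed
qed

text \<open>Frequencies \<open>h\<close> below a cutoff \<open>H\<close> of order \<open>N powr \<alpha>\<close> have distance at least a constant times
  \<open>H powr (1 - \<mu>)\<close> from the integers after multiplication by the irrational number. Their exponential
  sums are hence at most \<open>exp (- K * N powr (1 - 2 * \<alpha> * (\<mu> - 1)))\<close>, which beats every power of
  \<open>N\<close>; the smoothing error \<open>H powr (-1/3)\<close> remains.\<close>

lemma discrepancy_sticks_bigo:
  fixes B m :: nat and L :: real and p :: "nat \<Rightarrow> real" and \<kappa> \<epsilon> :: real
  assumes B: "2 \<le> B" and L: "0 < L" and p: "\<And>i. i \<in> {1..m} \<Longrightarrow> 0 < p i"
    and i: "i \<in> {1..m - 1}" and irr: "log (real B) (p i / p (i + 1)) \<notin> \<rat>"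
    and \<kappa>: "irrationality_exponent (log (real B) (p i / p (i + 1))) = ereal \<kappa>" and "1 < \<kappa>"
    and \<alpha>: "0 < \<alpha>" "2 * \<alpha> * (\<kappa> - 1) < 1"
  shows "(\<lambda>N. discrepancy (map (log (real B)) (sticks m p L N))) \<in> O(\<lambda>N. real N powr (- \<alpha> / 3))"
proof -
  let ?y = "log (real B) (p i / p (i + 1))"
  have m: "0 < m" using i by auto
  have B1: "0 < real B" "real B \<noteq> 1" using B by auto
  (* \<mu> lies strictly between \<kappa> and 1 + 1 / (2 \<alpha>): above \<kappa> the Diophantine bound holds,
     and below 1 + 1 / (2 \<alpha>) the power \<beta> of N in the exponential is positive. *)
  define w where "w = 1 / (2 * \<alpha>)"
  define \<mu> where "\<mu> = 1 + ((\<kappa> - 1) + w) / 2"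
  have "\<kappa> - 1 < w" using \<alpha> by (simp add: w_def field_simps)
  then have \<mu>: "\<kappa> < \<mu>" "1 < \<mu>" "\<mu> - 1 < w"
    using \<open>1 < \<kappa>\<close> by (simp_all add: \<mu>_def field_simps)
  define \<beta> where "\<beta> = 1 - 2 * \<alpha> * (\<mu> - 1)"
  have \<beta>: "0 < \<beta>" using \<mu>(3) \<alpha> by (simp add: \<beta>_def w_def field_simps)
  obtain c where c: "0 < c"
    "\<And>(q::nat) (a::int). 0 < q \<Longrightarrow> c * real q powr (1 - \<mu>) \<le> \<bar>real q * ?y - of_int a\<bar>"
    using irrational_approximation_ge[OF irr, of \<mu>] \<kappa> \<mu> by (metis ereal_less_eq(3) less_ereal.simps(1) less_imp_le)
  define K where "K = 4 * c\<^sup>2 * 2 powr (2 * (1 - \<mu>)) / real m"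
  have K: "0 < K" using c m by (simp add: K_def)
  have bound: "\<bar>discrepancy (map (log (real B)) (sticks m p L N))\<bar>
      \<le> 2 * real N powr (- \<alpha> / 3) + 4 * real N powr \<alpha> * exp (- (K * real N powr \<beta>))" if "1 \<le> N" for N
  proof -
    define H where "H = nat \<lceil>real N powr \<alpha>\<rceil>"
    have N1: "1 \<le> real N powr \<alpha>" using that \<alpha> by (simp add: ge_one_powr_ge_zero)
    then have H: "real N powr \<alpha> \<le> real H" "real H \<le> 2 * real N powr \<alpha>" "0 < H"
      unfolding H_def by linarith+
    define T where "T = exp (- (K * real N powr \<beta>))"
    have "cmod (\<Sum>j<m ^ N. cis (2 * pi * real h * log (real B) (sticks m p L N ! j))) \<le> T * real (m ^ N)"
      if h: "0 < h" "h < H" for h :: nat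
    proof -
      define d where "d = c * (2 * real N powr \<alpha>) powr (1 - \<mu>)"
      have "real h \<le> 2 * real N powr \<alpha>" using h H by linarith
      then have "(2 * real N powr \<alpha>) powr (1 - \<mu>) \<le> real h powr (1 - \<mu>)"
        using h \<mu> by (intro powr_mono2') auto
      then have "d \<le> c * real h powr (1 - \<mu>)" unfolding d_def using c by (intro mult_left_mono) auto
      then have d: "d \<le> \<bar>real h * ?y - of_int k\<bar>" for k :: int using c(2)[OF h(1), of k] by linarith
      have "0 \<le> d" using c by (simp add: d_def)
      have "d\<^sup>2 * real N = c\<^sup>2 * ((2 * real N powr \<alpha>) powr (2 * (1 - \<mu>))) * real N powr 1"
        by (simp add: d_def power_mult_distrib power2_eq_square algebra_simps flip: powr_add)
      also have "\<dots> = c\<^sup>2 * 2 powr (2 * (1 - \<mu>)) * (real N powr (\<alpha> * (2 * (1 - \<mu>))) * real N powr 1)"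
        by (simp add: powr_mult powr_powr)
      also have "\<dots> = c\<^sup>2 * 2 powr (2 * (1 - \<mu>)) * real N powr \<beta>"
        unfolding powr_add[symmetric] by (simp add: \<beta>_def algebra_simps)
      finally have "- 4 * d\<^sup>2 / real m * real N = - (K * real N powr \<beta>)"
        by (simp add: K_def field_simps)
      then show ?thesis
        using norm_sticks_character_le[OF B1 L p i \<open>0 \<le> d\<close> d, of N] by (simp add: T_def)
    qed
    from discrepancy_sticks_le[OF B L p m H(3) _ this]
    have "\<bar>discrepancy (map (log (real B)) (sticks m p L N))\<bar> \<le> 2 * real H powr (-1/3) + 2 * real H * T"
      by (simp add: T_def)
    also have "real H powr (-1/3) \<le> (real N powr \<alpha>) powr (-1/3)"
      using H N1 \<open>1 \<le> N\<close> by (intro powr_mono2') auto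
    also have "(real N powr \<alpha>) powr (-1/3) = real N powr (- \<alpha> / 3)" by (simp add: powr_powr)
    also have "2 * real H * T \<le> 2 * (2 * real N powr \<alpha>) * T"
      using H by (intro mult_right_mono mult_left_mono) (auto simp: T_def)
    finally show ?thesis by (simp add: T_def)
  qed
  have "(\<lambda>N. discrepancy (map (log (real B)) (sticks m p L N)))
      \<in> O(\<lambda>N::nat. 2 * real N powr (- \<alpha> / 3) + 4 * real N powr \<alpha> * exp (- (K * real N powr \<beta>)))"
    by (intro bigoI[of _ 1] eventually_mono[OF eventually_ge_at_top[of 1]])
       (use bound in \<open>force intro: order_trans[OF _ abs_ge_self]\<close>)
  also have "(\<lambda>N::nat. 2 * real N powr (- \<alpha> / 3) + 4 * real N powr \<alpha> * exp (- (K * real N powr \<beta>)))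
      \<in> O(\<lambda>N. real N powr (- \<alpha> / 3))"
    using \<alpha>(1) \<beta> K by real_asymp
  finally show ?thesis .
qed

lemma discrepancy_sticks_bounded:
  assumes "2 \<le> B" "0 < L" "\<And>i. i \<in> {1..m} \<Longrightarrow> 0 < p i" "0 < m" "0 \<le> e"
  shows "(\<lambda>N. discrepancy (map (log (real B)) (sticks m p L N))) \<in> O(\<lambda>N. real N powr e)"
proof (rule bigoI[of _ 2], rule eventually_mono[OF eventually_ge_at_top[of 1]])
  fix N :: nat assume "1 \<le> N"
  then have "1 \<le> real N powr e" using assms by (simp add: ge_one_powr_ge_zero)
  moreover have "\<bar>discrepancy (map (log (real B)) (sticks m p L N))\<bar> \<le> 2"
    using discrepancy_sticks_le[where B = B and L = L and p = p and m = m and N = N and H = 1 and T = 0] assms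
    by simp
  ultimately show "norm (discrepancy (map (log (real B)) (sticks m p L N))) \<le> 2 * norm (real N powr e)" by simp
qed

theorem theorem2:
  fixes B m :: nat and L :: real and p y :: "nat \<Rightarrow> real"
  assumes "2 \<le> B" and "0 < L" and "2 < m"
    and "\<forall>i\<in>{1..m-1}. 0 < p i \<and> p i < 1"
    and "(\<Sum>i=1..m-1. p i) < 1"
    and "p m = 1 - (\<Sum>i=1..m-1. p i)"
    and "\<forall>i\<in>{1..m-1}. y i = log (real B) (p i / p (i + 1))"
  shows "(strong_benford B (\<lambda>N. uniform_count_measure {..<m ^ N}) (\<lambda>N j. sticks m p L N ! j)
            \<longleftrightarrow> (\<exists>i\<in>{1..m-1}. y i \<notin> \<rat>)) \<and>
         ((\<exists>i\<in>{1..m-1}. y i \<notin> \<rat>) \<longrightarrow>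
            (let \<kappa>0 = Min {irrationality_exponent (y i) | i. i \<in> {1..m-1} \<and> y i \<notin> \<rat>} in
              \<exists>\<delta>>0. \<forall>\<epsilon>>0.
                (\<lambda>N. discrepancy (map (log (real B)) (sticks m p L N)))
                  \<in> O(\<lambda>N. real N powr (\<delta> * (- (if \<kappa>0 = \<infinity> then 0 else 1 / (real_of_ereal \<kappa>0 - 1)) + \<epsilon>)))))"
proof -
  note B = assms(1) and L = assms(2)
  have m: "0 < m" using assms(3) by simp
  have p: "0 < p i" if "i \<in> {1..m}" for i
    using assms(4-6) that by (cases "i = m") auto
  have y: "y i = log (real B) (p i / p (i + 1))" if "i \<in> {1..m - 1}" for i
    using assms(7) that by blast
  have "strong_benford B (\<lambda>N. uniform_count_measure {..<m ^ N}) (\<lambda>N j. sticks m p L N ! j)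
            \<longleftrightarrow> (\<exists>i\<in>{1..m-1}. y i \<notin> \<rat>)" (is ?benford)
  proof
    assume *: "strong_benford B (\<lambda>N. uniform_count_measure {..<m ^ N}) (\<lambda>N j. sticks m p L N ! j)"
    show "\<exists>i\<in>{1..m-1}. y i \<notin> \<rat>"
    proof (rule ccontr)
      assume "\<not> ?thesis"
      then have "log (real B) (p i / p (i + 1)) \<in> \<rat>" if "i \<in> {1..m - 1}" for i
        using that y by metis
      then show False using rational_imp_not_benford[where p = p, OF B L p m] * by blast
    qed
  next
    assume "\<exists>i\<in>{1..m-1}. y i \<notin> \<rat>"
    then show "strong_benford B (\<lambda>N. uniform_count_measure {..<m ^ N}) (\<lambda>N j. sticks m p L N ! j)"
      using irrational_imp_benford[where p = p, OF B L p] y by metis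
  qed
  moreover have "let \<kappa>0 = Min {irrationality_exponent (y i) | i. i \<in> {1..m-1} \<and> y i \<notin> \<rat>} in
              \<exists>\<delta>>0. \<forall>\<epsilon>>0.
                (\<lambda>N. discrepancy (map (log (real B)) (sticks m p L N)))
                  \<in> O(\<lambda>N. real N powr (\<delta> * (- (if \<kappa>0 = \<infinity> then 0 else 1 / (real_of_ereal \<kappa>0 - 1)) + \<epsilon>)))"
    if ex: "\<exists>i\<in>{1..m-1}. y i \<notin> \<rat>"
  proof -
    let ?K = "{irrationality_exponent (y i) | i. i \<in> {1..m-1} \<and> y i \<notin> \<rat>}"
    define \<kappa>0 where "\<kappa>0 = Min ?K"
    define E where "E = (if \<kappa>0 = \<infinity> then 0 else 1 / (real_of_ereal \<kappa>0 - 1))"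
    have "finite ?K" "?K \<noteq> {}" using ex by auto
    then have "\<kappa>0 \<in> ?K" unfolding \<kappa>0_def by (rule Min_in)
    then obtain i where i: "i \<in> {1..m - 1}" "y i \<notin> \<rat>" "\<kappa>0 = irrationality_exponent (y i)" by blast
    (* \<delta> = 1/6 = (1/2) (1/3): frequencies up to a power of N just below N^(E/2) are damped, and the
       smoothing turns a cutoff H into an error H^(-1/3). *)
    have "(\<lambda>N. discrepancy (map (log (real B)) (sticks m p L N))) \<in> O(\<lambda>N. real N powr (1/6 * (- E + \<epsilon>)))"
      if "0 < \<epsilon>" for \<epsilon>
    proof (cases "0 \<le> - E + \<epsilon>")
      case True
      (* A nonnegative exponent asks for boundedness only; this covers \<kappa>0 = \<infinity>, where E = 0. *)
      then have "0 \<le> 1/6 * (- E + \<epsilon>)" by simp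
      then show ?thesis by (intro discrepancy_sticks_bounded B L p m)
    next
      case False
      then have E: "\<epsilon> < E" by simp
      then have fin: "\<kappa>0 \<noteq> \<infinity>" and E_eq: "E = 1 / (real_of_ereal \<kappa>0 - 1)"
        using \<open>0 < \<epsilon>\<close> by (auto simp: E_def split: if_splits)
      define \<kappa> where "\<kappa> = real_of_ereal \<kappa>0"
      have \<kappa>1: "1 < \<kappa>" using E \<open>0 < \<epsilon>\<close> unfolding E_eq \<kappa>_def
        by (metis diff_gt_0_iff_gt less_trans zero_less_divide_1_iff)
      then have \<kappa>: "\<kappa>0 = ereal \<kappa>" using fin unfolding \<kappa>_def by (cases \<kappa>0) auto
      define \<alpha> where "\<alpha> = (E - \<epsilon>) / 2"
      have "0 < \<alpha>" using E by (simp add: \<alpha>_def)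
      moreover have "2 * \<alpha> * (\<kappa> - 1) < 1"
      proof -
        have "2 * \<alpha> * (\<kappa> - 1) < E * (\<kappa> - 1)"
          using \<kappa>1 \<open>0 < \<epsilon>\<close> by (intro mult_strict_right_mono) (auto simp: \<alpha>_def)
        also have "\<dots> = 1" using \<kappa>1 by (simp add: E_eq flip: \<kappa>_def)
        finally show ?thesis .
      qed
      moreover have "log (real B) (p i / p (i + 1)) \<notin> \<rat>"
        "irrationality_exponent (log (real B) (p i / p (i + 1))) = ereal \<kappa>"
        using i y[OF i(1)] \<kappa> by auto
      ultimately have "(\<lambda>N. discrepancy (map (log (real B)) (sticks m p L N))) \<in> O(\<lambda>N. real N powr (- \<alpha> / 3))"
        using \<kappa>1 by (intro discrepancy_sticks_bigo[where \<kappa> = \<kappa> and i = i] B L p i(1))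
      moreover have "- \<alpha> / 3 = 1/6 * (- E + \<epsilon>)" by (simp add: \<alpha>_def field_simps)
      ultimately show ?thesis by (simp only:)
    qed
    then show ?thesis
      unfolding Let_def \<kappa>0_def[symmetric] E_def[symmetric] by (intro exI[of _ "1/6"]) simp
  qed
  ultimately show ?thesis by blast
qed

end
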